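(* Let $a, b$ be two positive real numbers and $\nu \in (0,1)$. Then $$a\nabla_{\nu} b \geq a\sharp_{\nu} b + \sum_{k=0}^{\infty} r_k\Big[\big(a^{1-\frac{m_k}{2^k}} b^{\frac{m_k}{2^k}}\big)^{\frac12} - \big(a^{1-\frac{m_k+1}{2^k}} b^{\frac{m_k+1}{2^k}}\big)^{\frac12}\Big]^2 .$$ In addition, if $\nu = \frac{t}{2^n}$ for some $t, n \in \mathbb{N}$, then $$a\nabla_{\nu} b = a\sharp_{\nu} b + \sum_{k=0}^{n-1} r_k\Big[\big(a^{1-\frac{m_k}{2^k}} b^{\frac{m_k}{2^k}}\big)^{\frac12} - \big(a^{1-\frac{m_k+1}{2^k}} b^{\frac{m_k+1}{2^k}}\big)^{\frac12}\Big]^2 .$$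
   Context: For positive reals $a,b$ and $\nu\in[0,1]$: $a\nabla_\nu b = (1-\nu)a+\nu b$ and $a\sharp_\nu b = a^{1-\nu}b^{\nu}$. For $0<\nu<1$ and integers $k\ge 0$, $m_k=\lfloor 2^k\nu\rfloor$ is the largest integer not greater than $2^k\nu$; $r_0=\min\{\nu,1-\nu\}$ and $r_k=\min\{2r_{k-1},\,1-2r_{k-1}\}$ for $k\ge 1$. The infinite series has nonnegative terms and is convergent. *)

theory Defs
  imports Complex_Main
begin

definition arith_mean :: "real \<Rightarrow> real \<Rightarrow> real \<Rightarrow> real" where
  "arith_mean \<nu> a b = (1 - \<nu>) * a + \<nu> * b"

definition geom_mean :: "real \<Rightarrow> real \<Rightarrow> real \<Rightarrow> real" where
  "geom_mean \<nu> a b = a powr (1 - \<nu>) * b powr \<nu>"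

definition dyadic_floor :: "real \<Rightarrow> nat \<Rightarrow> int" where
  "dyadic_floor \<nu> k = \<lfloor>2 ^ k * \<nu>\<rfloor>"

primrec refine_coeff :: "real \<Rightarrow> nat \<Rightarrow> real" where
  "refine_coeff \<nu> 0 = min \<nu> (1 - \<nu>)"
| "refine_coeff \<nu> (Suc k) = min (2 * refine_coeff \<nu> k) (1 - 2 * refine_coeff \<nu> k)"

definition refine_term :: "real \<Rightarrow> real \<Rightarrow> real \<Rightarrow> nat \<Rightarrow> real" where
  "refine_term \<nu> a b k =
     refine_coeff \<nu> k *
       ((a powr (1 - of_int (dyadic_floor \<nu> k) / 2 ^ k)
           * b powr (of_int (dyadic_floor \<nu> k) / 2 ^ k)) powr (1 / 2)
        - (a powr (1 - (of_int (dyadic_floor \<nu> k) + 1) / 2 ^ k)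
           * b powr ((of_int (dyadic_floor \<nu> k) + 1) / 2 ^ k)) powr (1 / 2)) ^ 2"

end

(* Put f x = geom_mean x a b, so that f ((x + y) / 2) = sqrt (f x * f y), and let L k be the value
   at \<nu> of the piecewise linear interpolant of f with nodes in the multiples of 1 / 2^k. Halving
   the mesh lowers this value by exactly the k-th correction term, so the partial sums telescope to
   L 0 - L n, where L 0 is the arithmetic mean. Convexity of f gives f \<nu> \<le> L n, with equality
   if \<nu> is a multiple of 1 / 2^n. *)
theory Submission
  imports Defs
begin

text \<open>The relative position of \<nu> in its dyadic cell of level \<open>k\<close>, hence the
  weight of the right node in the interpolation.\<close>

definition dyadic_frac :: "real \<Rightarrow> nat \<Rightarrow> real" where
  "dyadic_frac \<nu> k = frac (2 ^ k * \<nu>)"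

definition dyadic_chord :: "(real \<Rightarrow> real) \<Rightarrow> real \<Rightarrow> nat \<Rightarrow> real" where
  "dyadic_chord f \<nu> k =
     (1 - dyadic_frac \<nu> k) * f (of_int (dyadic_floor \<nu> k) / 2 ^ k)
       + dyadic_frac \<nu> k * f ((of_int (dyadic_floor \<nu> k) + 1) / 2 ^ k)"

lemma dyadic_frac_bounds: "0 \<le> dyadic_frac \<nu> k" "dyadic_frac \<nu> k < 1"
  by (simp_all add: dyadic_frac_def frac_lt_1)

lemma dyadic_floor_plus_frac: "of_int (dyadic_floor \<nu> k) + dyadic_frac \<nu> k = 2 ^ k * \<nu>"
  by (simp add: dyadic_floor_def dyadic_frac_def frac_def)

lemma dyadic_floor_frac_unique:
  assumes "of_int m + u = 2 ^ k * \<nu>" "0 \<le> u" "u < 1"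
  shows "dyadic_floor \<nu> k = m" "dyadic_frac \<nu> k = u"
proof -
  show "dyadic_floor \<nu> k = m"
    unfolding dyadic_floor_def by (rule floor_unique) (use assms in linarith)+
  then show "dyadic_frac \<nu> k = u"
    using dyadic_floor_plus_frac[of \<nu> k] assms(1) by simp
qed

text \<open>Doubling \<open>m + u\<close> gives \<open>2 * m + 2 * u\<close>. For
  \<open>u < 1 / 2\<close> nothing carries over, so \<nu> lies in the left half of its cell; in the
  complementary case a 1 is carried and the right half is taken.\<close>

lemma dyadic_Suc_lower:
  assumes "dyadic_frac \<nu> k < 1 / 2"
  shows "dyadic_floor \<nu> (Suc k) = 2 * dyadic_floor \<nu> k"
    and "dyadic_frac \<nu> (Suc k) = 2 * dyadic_frac \<nu> k"
  using assms dyadic_floor_plus_frac[of \<nu> k] dyadic_frac_bounds[of \<nu> k]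
    dyadic_floor_frac_unique[of "2 * dyadic_floor \<nu> k" "2 * dyadic_frac \<nu> k" "Suc k" \<nu>]
  by simp_all

lemma dyadic_Suc_upper:
  assumes "dyadic_frac \<nu> k \<ge> 1 / 2"
  shows "dyadic_floor \<nu> (Suc k) = 2 * dyadic_floor \<nu> k + 1"
    and "dyadic_frac \<nu> (Suc k) = 2 * dyadic_frac \<nu> k - 1"
  using assms dyadic_floor_plus_frac[of \<nu> k] dyadic_frac_bounds[of \<nu> k]
    dyadic_floor_frac_unique[of "2 * dyadic_floor \<nu> k + 1" "2 * dyadic_frac \<nu> k - 1" "Suc k" \<nu>]
  by simp_all

text \<open>The recursion for the coefficients is the tent map, while fractional parts follow the
  doubling map. The distance to the nearest integer, \<open>min u (1 - u)\<close>, carries the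
  second into the first because it is symmetric under exchanging \<open>u\<close> and
  \<open>1 - u\<close>.\<close>

lemma refine_coeff_eq_min_frac:
  assumes "0 < \<nu>" "\<nu> < 1"
  shows "refine_coeff \<nu> k = min (dyadic_frac \<nu> k) (1 - dyadic_frac \<nu> k)"
proof (induction k)
  case 0
  have "dyadic_frac \<nu> 0 = \<nu>"
    by (rule dyadic_floor_frac_unique(2)[of 0]) (use assms in auto)
  then show ?case by simp
next
  case (Suc k)
  show ?case
  proof (cases "dyadic_frac \<nu> k < 1 / 2")
    case True
    then show ?thesis using Suc dyadic_Suc_lower(2)[of \<nu> k] by simp
  next
    case False
    then show ?thesis using Suc dyadic_Suc_upper(2)[of \<nu> k] by (simp add: min_def)
  qed
qed

text \<open>With end values \<open>s\<^sup>2\<close> and \<open>t\<^sup>2\<close> on a cell, the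
  midpoint value is \<open>s * t\<close>. Replacing the chord over the cell by the chord over one
  half then changes only a quadratic form in \<open>s\<close> and \<open>t\<close>, which is a
  multiple of \<open>(s - t)\<^sup>2\<close>.\<close>

lemma dyadic_chord_Suc:
  assumes pos: "\<And>x. f x > 0"
    and mid: "\<And>x y. f ((x + y) / 2) = sqrt (f x) * sqrt (f y)"
    and "0 < \<nu>" "\<nu> < 1"
  shows "dyadic_chord f \<nu> k = dyadic_chord f \<nu> (Suc k) + refine_coeff \<nu> k *
     (sqrt (f (of_int (dyadic_floor \<nu> k) / 2 ^ k))
      - sqrt (f ((of_int (dyadic_floor \<nu> k) + 1) / 2 ^ k))) ^ 2"
proof -
  define m u where "m = real_of_int (dyadic_floor \<nu> k)" and "u = dyadic_frac \<nu> k"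
  define s t where "s = sqrt (f (m / 2 ^ k))" and "t = sqrt (f ((m + 1) / 2 ^ k))"
  have s2: "f (m / 2 ^ k) = s\<^sup>2" and t2: "f ((m + 1) / 2 ^ k) = t\<^sup>2"
    using pos by (simp_all add: s_def t_def less_imp_le)
  \<comment> \<open>The only new node of level \<open>Suc k\<close> in this cell is its
    midpoint.\<close>
  have "(2 * m + 1) / 2 ^ Suc k = (m / 2 ^ k + (m + 1) / 2 ^ k) / 2"
    by (simp add: field_simps)
  then have st: "f ((2 * m + 1) / 2 ^ Suc k) = s * t"
    by (simp only: mid s_def t_def)
  have chord: "dyadic_chord f \<nu> k = (1 - u) * s\<^sup>2 + u * t\<^sup>2"
    by (simp add: dyadic_chord_def m_def[symmetric] u_def[symmetric] s2 t2)
  have coeff: "refine_coeff \<nu> k = min u (1 - u)"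
    using refine_coeff_eq_min_frac[OF assms(3,4)] by (simp add: u_def)
  have "dyadic_chord f \<nu> k = dyadic_chord f \<nu> (Suc k) + refine_coeff \<nu> k * (s - t)\<^sup>2"
  proof (cases "u < 1 / 2")
    case True
    have "2 * m / 2 ^ Suc k = m / 2 ^ k"
      by simp
    \<comment> \<open>Left half: the midpoint is the new right node, and the drop is
      \<open>u * (s - t)\<^sup>2\<close>.\<close>
    then have "dyadic_chord f \<nu> (Suc k) = (1 - 2 * u) * s\<^sup>2 + 2 * u * (s * t)"
      using True dyadic_Suc_lower[of \<nu> k] st s2
      by (simp add: dyadic_chord_def m_def[symmetric] u_def[symmetric])
    moreover have "refine_coeff \<nu> k = u"
      using True coeff by simp
    ultimately show ?thesis
      by (simp only: chord) (simp add: power2_eq_square algebra_simps)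
  next
    case False
    have "(2 * m + 1 + 1) / 2 ^ Suc k = (m + 1) / 2 ^ k"
      by (simp add: field_simps)
    \<comment> \<open>Right half: the midpoint is the new left node, and the drop is
      \<open>(1 - u) * (s - t)\<^sup>2\<close>.\<close>
    then have "dyadic_chord f \<nu> (Suc k) = (2 - 2 * u) * (s * t) + (2 * u - 1) * t\<^sup>2"
      using False dyadic_Suc_upper[of \<nu> k] st t2
      by (simp add: dyadic_chord_def m_def[symmetric] u_def[symmetric])
    moreover have "refine_coeff \<nu> k = 1 - u"
      using False coeff by simp
    ultimately show ?thesis
      by (simp only: chord) (simp add: power2_eq_square algebra_simps)
  qed
  then show ?thesis by (simp add: s_def t_def m_def)
qed

lemma geom_mean_eq_exp:
  assumes "a > 0" "b > 0"
  shows "geom_mean x a b = exp ((1 - x) * ln a + x * ln b)"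
  using assms by (simp add: geom_mean_def powr_def exp_add)

lemma geom_mean_midpoint:
  assumes "a > 0" "b > 0"
  shows "geom_mean ((x + y) / 2) a b = sqrt (geom_mean x a b) * sqrt (geom_mean y a b)"
proof -
  have "(geom_mean ((x + y) / 2) a b)\<^sup>2 = geom_mean x a b * geom_mean y a b"
    using assms
    by (simp add: geom_mean_eq_exp power2_eq_square exp_add[symmetric])
       (simp add: algebra_simps flip: add_divide_distrib)
  then show ?thesis
    using assms by (simp add: geom_mean_eq_exp flip: real_sqrt_mult real_sqrt_unique)
qed

text \<open>This is \<open>exp z \<ge> 1 + z\<close> scaled by \<open>geom_mean x a b\<close>: the
  graph lies above its tangent at \<open>x\<close>, whose slope is
  \<open>geom_mean x a b * (ln b - ln a)\<close>.\<close>

lemma geom_mean_ge_tangent: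
  assumes "a > 0" "b > 0"
  shows "geom_mean x a b * (1 + (y - x) * (ln b - ln a)) \<le> geom_mean y a b"
proof -
  have "geom_mean y a b = geom_mean x a b * exp ((y - x) * (ln b - ln a))"
    using assms by (simp add: geom_mean_eq_exp exp_add[symmetric] algebra_simps)
  then show ?thesis
    using assms by (simp add: geom_mean_eq_exp exp_ge_add_one_self)
qed

lemma geom_mean_le_dyadic_chord:
  assumes "a > 0" "b > 0"
  shows "geom_mean \<nu> a b \<le> dyadic_chord (\<lambda>x. geom_mean x a b) \<nu> k"
proof -
  define m u where "m = real_of_int (dyadic_floor \<nu> k)" and "u = dyadic_frac \<nu> k"
  define G d where "G = geom_mean \<nu> a b" and "d = ln b - ln a"
  have \<nu>: "\<nu> = (m + u) / 2 ^ k"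
    using dyadic_floor_plus_frac[of \<nu> k] by (simp add: m_def u_def)
  have u: "0 \<le> u" "u \<le> 1"
    using dyadic_frac_bounds[of \<nu> k] by (simp_all add: u_def)
  \<comment> \<open>The tangent at \<nu> is averaged over the two nodes. As \<nu> is the average of
    the nodes with the same weights, the linear terms cancel and \<open>G\<close> remains.\<close>
  have "G = (1 - u) * (G * (1 + (m / 2 ^ k - \<nu>) * d)) + u * (G * (1 + ((m + 1) / 2 ^ k - \<nu>) * d))"
    by (simp add: \<nu> field_simps)
  also have "\<dots> \<le> (1 - u) * geom_mean (m / 2 ^ k) a b + u * geom_mean ((m + 1) / 2 ^ k) a b"
    unfolding G_def d_def
    by (intro add_mono mult_left_mono geom_mean_ge_tangent assms) (use u in auto)
  finally show ?thesis
    by (simp add: dyadic_chord_def G_def m_def u_def)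
qed

lemma refine_term_eq_sqrt:
  "refine_term \<nu> a b k = refine_coeff \<nu> k *
     (sqrt (geom_mean (of_int (dyadic_floor \<nu> k) / 2 ^ k) a b)
      - sqrt (geom_mean ((of_int (dyadic_floor \<nu> k) + 1) / 2 ^ k) a b)) ^ 2"
  by (simp add: refine_term_def geom_mean_def powr_half_sqrt)

lemma arith_mean_eq_dyadic_chord:
  assumes "a > 0" "b > 0" "0 < \<nu>" "\<nu> < 1"
  shows "arith_mean \<nu> a b =
    dyadic_chord (\<lambda>x. geom_mean x a b) \<nu> n + (\<Sum>k<n. refine_term \<nu> a b k)"
proof (induction n)
  case 0
  \<comment> \<open>At mesh 1 the nodes are 0 and 1, where the geometric mean takes the values
    \<open>a\<close> and \<open>b\<close>.\<close>
  have "dyadic_floor \<nu> 0 = 0" "dyadic_frac \<nu> 0 = \<nu>"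
    using dyadic_floor_frac_unique[of 0 \<nu> 0 \<nu>] assms by simp_all
  then show ?case
    using assms by (simp add: arith_mean_def dyadic_chord_def geom_mean_def)
next
  case (Suc n)
  have "dyadic_chord (\<lambda>x. geom_mean x a b) \<nu> n =
      dyadic_chord (\<lambda>x. geom_mean x a b) \<nu> (Suc n) + refine_term \<nu> a b n"
    unfolding refine_term_eq_sqrt
    by (rule dyadic_chord_Suc)
       (use assms geom_mean_midpoint in \<open>simp_all add: geom_mean_eq_exp\<close>)
  then show ?case using Suc by simp
qed

lemma refine_term_nonneg:
  assumes "0 < \<nu>" "\<nu> < 1"
  shows "0 \<le> refine_term \<nu> a b k"
  using dyadic_frac_bounds[of \<nu> k] refine_coeff_eq_min_frac[OF assms]
  by (simp add: refine_term_def)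

theorem theorem2p1:
  fixes a b \<nu> :: real
  assumes "a > 0" and "b > 0" and "0 < \<nu>" and "\<nu> < 1"
  shows "summable (refine_term \<nu> a b)
    \<and> arith_mean \<nu> a b \<ge> geom_mean \<nu> a b + (\<Sum>k. refine_term \<nu> a b k)
    \<and> (\<forall>t n :: nat. \<nu> = real t / 2 ^ n \<longrightarrow>
          arith_mean \<nu> a b = geom_mean \<nu> a b + (\<Sum>k<n. refine_term \<nu> a b k))"
proof (intro conjI allI impI)
  \<comment> \<open>A bound uniform in \<open>n\<close> serves twice: with nonnegative terms it
    gives convergence, and it passes to the infinite sum.\<close>
  have bound: "(\<Sum>k<n. refine_term \<nu> a b k) \<le> arith_mean \<nu> a b - geom_mean \<nu> a b" for n
    using arith_mean_eq_dyadic_chord[OF assms, of n]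
      geom_mean_le_dyadic_chord[OF assms(1,2), of \<nu> n] by linarith
  show summable: "summable (refine_term \<nu> a b)"
    by (rule summableI_nonneg_bounded[OF refine_term_nonneg[OF assms(3,4)] bound])
  show "arith_mean \<nu> a b \<ge> geom_mean \<nu> a b + (\<Sum>k. refine_term \<nu> a b k)"
    using suminf_le_const[OF summable bound] by simp
next
  fix t n :: nat
  assume t: "\<nu> = real t / 2 ^ n"
  \<comment> \<open>Here \<nu> is itself a node of level \<open>n\<close>, so the interpolation puts
    all its weight on the value at \<nu>.\<close>
  have "dyadic_floor \<nu> n = int t" "dyadic_frac \<nu> n = 0"
    using dyadic_floor_frac_unique[of "int t" 0 n \<nu>] by (simp_all add: t)
  then have "dyadic_chord (\<lambda>x. geom_mean x a b) \<nu> n = geom_mean \<nu> a b"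
    by (simp add: dyadic_chord_def t)
  then show "arith_mean \<nu> a b = geom_mean \<nu> a b + (\<Sum>k<n. refine_term \<nu> a b k)"
    using arith_mean_eq_dyadic_chord[OF assms, of n] by simp
qed

end
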